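(* Let $T>0$, let $\varphi\in C_b([0,T];\mathbb{C})$ and let $f:\mathbb{R}\to\mathbb{C}$ be (the restriction to $\mathbb{R}$ of) an analytic function of exponential type. Consider the initial value problem $$\partial_t u(t,x)=\frac{\alpha}{N!}(\varphi(t))^N\,\partial_x^N u(t,x),\qquad u(0,x)=f(x),\qquad x\in\mathbb{R}.$$ Then the function $u$ defined by $$u(t,x)=\lim_{n\to\infty}\mathbb{E}\left[f\left(x+\int_0^t\varphi(s)\,dW_n(s)\right)\right],\qquad t\in[0,T],\ x\in\mathbb{R},$$ is a classical solution of this problem (for $t\in[0,T]$).
   Context: Let $N>2$ be an integer and $\alpha\in\mathbb{C}$; fix an $N$-th root $\alpha^{1/N}$ of $\alpha$. Let $\xi$ be a random variable uniformly distributed on $\{\alpha^{1/N}e^{2\pi i k/N}:k=0,\dots,N-1\}$, let $(\xi_k)_{k\ge1}$ be i.i.d. copies of $\xi$ on a probability space, and for each integer $n\ge1$ and real $t\ge0$ set $W_n(t)=n^{-1/N}\sum_{k=1}^{\lfloor nt\rfloor}\xi_k$. For $\varphi:[0,T]\to\mathbb{C}$ the Wiener integral is $$\int_0^t\varphi(s)\,dW_n(s)=\frac{1}{n^{1/N}}\sum_{\tau=0}^{\lfloor nt\rfloor-1}\varphi(\tfrac{\tau}{n})\,\xi_{\tau+1}.$$ An analytic function $f(z)=\sum_{k\ge0}\frac{b_k}{k!}z^k$ is of exponential type $c$ if $|b_k|^{1/k}\to c$ as $k\to\infty$; "of exponential type" means of exponential type $c$ for some $c<\infty$. Such $f$ is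 entire, and $f$ in the expectation denotes its entire extension to $\mathbb{C}$. $C_b([0,T];\mathbb{C})$ is the space of bounded continuous functions. *)

theory Defs
  imports "HOL-Probability.Probability"
begin

definition scaled_roots_of_unity :: "nat \<Rightarrow> complex \<Rightarrow> complex set" where
  "scaled_roots_of_unity N a = (\<lambda>k. a * cis (2 * pi * real k / real N)) ` {..<N}"

definition uniformly_distributed_on :: "'a measure \<Rightarrow> ('a \<Rightarrow> complex) \<Rightarrow> complex set \<Rightarrow> bool" where
  "uniformly_distributed_on M X S \<longleftrightarrow>
     X \<in> borel_measurable M \<and> distr M borel X = distr (uniform_count_measure S) borel (\<lambda>z. z)"

text \<open>The variables are indexed from 1; \<open>\<xi> 0\<close> plays no role.\<close>

definition iid_uniform :: "'a measure \<Rightarrow> (nat \<Rightarrow> 'a \<Rightarrow> complex) \<Rightarrow> complex set \<Rightarrow> bool" where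
  "iid_uniform M \<xi> S \<longleftrightarrow>
     prob_space.indep_vars M (\<lambda>_. borel) \<xi> {1..} \<and>
     (\<forall>k\<ge>1. uniformly_distributed_on M (\<xi> k) S)"

definition random_walk :: "nat \<Rightarrow> (nat \<Rightarrow> 'a \<Rightarrow> complex) \<Rightarrow> nat \<Rightarrow> real \<Rightarrow> 'a \<Rightarrow> complex" where
  "random_walk N \<xi> n t \<omega> =
     (\<Sum>k = 1..nat \<lfloor>real n * t\<rfloor>. \<xi> k \<omega>) / complex_of_real (root N (real n))"

definition wiener_integral ::
  "nat \<Rightarrow> (nat \<Rightarrow> 'a \<Rightarrow> complex) \<Rightarrow> nat \<Rightarrow> (real \<Rightarrow> complex) \<Rightarrow> real \<Rightarrow> 'a \<Rightarrow> complex" where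
  "wiener_integral N \<xi> n \<phi> t \<omega> =
     (\<Sum>\<tau><nat \<lfloor>real n * t\<rfloor>. \<phi> (real \<tau> / real n) * \<xi> (Suc \<tau>) \<omega>) / complex_of_real (root N (real n))"

lemma wiener_integral_eq_increments:
  assumes "n > 0"
  shows "wiener_integral N \<xi> n \<phi> t \<omega> =
    (\<Sum>\<tau><nat \<lfloor>real n * t\<rfloor>. \<phi> (real \<tau> / real n) *
       (random_walk N \<xi> n (real (Suc \<tau>) / real n) \<omega> - random_walk N \<xi> n (real \<tau> / real n) \<omega>))"
proof -
  have *: "nat \<lfloor>real n * (real m / real n)\<rfloor> = m" for m
    using assms by simp
  have "random_walk N \<xi> n (real (Suc \<tau>) / real n) \<omega> - random_walk N \<xi> n (real \<tau> / real n) \<omega>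
      = \<xi> (Suc \<tau>) \<omega> / complex_of_real (root N (real n))" for \<tau>
    unfolding random_walk_def * by (simp add: add_divide_distrib)
  then show ?thesis
    unfolding wiener_integral_def by (simp add: sum_divide_distrib)
qed

text \<open>The definition asks for a genuine limit of \<open>\<bar>b\<^sub>k\<bar>\<^sup>1\<^sup>/\<^sup>k\<close>, not merely a limes superior.
  The type \<open>c\<close> is a real number, hence finite.\<close>

definition of_exponential_type :: "(complex \<Rightarrow> complex) \<Rightarrow> bool" where
  "of_exponential_type F \<longleftrightarrow>
     (\<exists>(b :: nat \<Rightarrow> complex) (c :: real).
        (\<forall>z. (\<lambda>k. b k / fact k * z ^ k) sums F z) \<and>
        (\<lambda>k. root k (cmod (b k))) \<longlonglongrightarrow> c)"

text \<open>Classical solution on \<open>[0,T] \<times> \<real>\<close> of \<open>\<partial>\<^sub>t u = A(t) \<partial>\<^sub>x\<^sup>N u\<close>, \<open>u(0,\<cdot>) = f\<close>: the derivatives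
  \<open>u\<^sub>t = \<partial>\<^sub>t u\<close> and \<open>D k = \<partial>\<^sub>x\<^sup>k u\<close> for \<open>k \<le> N\<close> exist, are jointly continuous, and satisfy the
  equation at every point. Time derivatives at \<open>0\<close> and \<open>T\<close> are one-sided.\<close>

definition classical_solution ::
  "real \<Rightarrow> nat \<Rightarrow> (real \<Rightarrow> complex) \<Rightarrow> (real \<Rightarrow> complex) \<Rightarrow> (real \<Rightarrow> real \<Rightarrow> complex) \<Rightarrow> bool" where
  "classical_solution T N A f u \<longleftrightarrow>
     (\<exists>(u\<^sub>t :: real \<Rightarrow> real \<Rightarrow> complex) (D :: nat \<Rightarrow> real \<Rightarrow> real \<Rightarrow> complex).
        (\<forall>t\<in>{0..T}. \<forall>x. D 0 t x = u t x) \<and>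
        (\<forall>k<N. \<forall>t\<in>{0..T}. \<forall>x. (D k t has_vector_derivative D (Suc k) t x) (at x)) \<and>
        (\<forall>t\<in>{0..T}. \<forall>x. ((\<lambda>s. u s x) has_vector_derivative u\<^sub>t t x) (at t within {0..T})) \<and>
        continuous_on ({0..T} \<times> UNIV) (\<lambda>(t, x). u\<^sub>t t x) \<and>
        (\<forall>k\<le>N. continuous_on ({0..T} \<times> UNIV) (\<lambda>(t, x). D k t x)) \<and>
        (\<forall>t\<in>{0..T}. \<forall>x. u\<^sub>t t x = A t * D N t x)) \<and>
     (\<forall>x. u 0 x = f x)"

end

theory Submission
  imports Defs "HOL-Complex_Analysis.Complex_Analysis"
begin

text \<open>
  Functions of exponential type are superpositions of exponentials with bounded frequencies: by the
  Borel transform (\<open>exponential_type_borel_representation\<close>),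
  \<open>F z\<close> is the integral over \<open>\<theta> \<in> [0, 1]\<close> of \<open>g \<theta> * exp (\<zeta> \<theta> * z)\<close> with \<open>g\<close> and \<open>\<zeta>\<close> continuous.
  It therefore suffices to understand exponential initial data, uniformly in the frequency.

  For a single frequency \<open>w\<close> the expectation of \<open>exp (w * S)\<close>, with \<open>S\<close> the Wiener integral,
  factorises by independence (\<open>expectation_exp_weighted_sum\<close>). Since the average of \<open>\<xi>\<^sup>j\<close> vanishes
  for \<open>0 < j < N\<close> and equals \<open>\<alpha>\<close> for \<open>j = N\<close>, each factor is
  \<open>1 + w\<^sup>N \<phi>(\<tau>/n)\<^sup>N \<alpha> / (N! n)\<close> up to \<open>o(1/n)\<close> (\<open>avg_exp_taylor\<close>). The product of the roughly \<open>n t\<close>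
  factors thus behaves like the exponential of a Riemann sum and tends to \<open>exp (K(t) w\<^sup>N)\<close>, where \<open>K(t)\<close>
  is the integral of \<open>\<alpha> / N! * \<phi>\<^sup>N\<close> over \<open>[0, t]\<close> (\<open>prod_avg_exp_limit\<close>). The products are bounded
  uniformly in \<open>n\<close> and in bounded \<open>w\<close>, so by dominated convergence
  (\<open>expectation_exponential_tendsto\<close>) \<open>u t x\<close> exists and is the integral of
  \<open>g \<theta> * exp (\<zeta> \<theta> * x + K(t) * \<zeta> \<theta> ^ N)\<close>.

  The integrand is smooth in \<open>x\<close> and \<open>K\<close> and \<open>\<theta>\<close> ranges over a compact interval, so one may
  differentiate under the integral sign. Every derivative in \<open>x\<close> produces a factor \<open>\<zeta>\<close>, while a
  derivative in \<open>t\<close> produces \<open>K'(t) * \<zeta>\<^sup>N\<close>, which is the equation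
  (\<open>exp_transform_classical_solution\<close>).
\<close>

section \<open>The Borel transform of a function of exponential type\<close>

lemma cmod_circlepath_0:
  assumes "R > 0"
  shows "cmod (circlepath 0 R \<theta>) = R"
proof -
  have "cmod (exp (2 * of_real pi * \<i> * of_real \<theta>)) = 1"
    using norm_exp_i_times[of "2 * pi * \<theta>"] by (simp add: algebra_simps)
  then show ?thesis using assms by (simp add: circlepath norm_mult)
qed

text \<open>Cauchy's formula for the \<open>k\<close>-th derivative of \<open>w \<mapsto> exp (w * z)\<close> at \<open>0\<close>, with the circle
  parametrised by \<open>[0, 1]\<close>: the derivative of the path contributes one factor of the path itself,
  which lowers the exponent \<open>k + 1\<close> to \<open>k\<close>.\<close>

lemma circle_integral_exp:
  fixes z :: complex
  assumes "R > 0"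
  shows "((\<lambda>\<theta>. exp (circlepath 0 R \<theta> * z) / circlepath 0 R \<theta> ^ k) has_integral z ^ k / fact k) {0..1}"
proof -
  have "((\<lambda>u. exp (u * z) / (u - 0) ^ Suc k) has_contour_integral
      ((2 * pi * \<i>) / (fact k) * (deriv ^^ k) (\<lambda>u. exp (u * z)) 0)) (circlepath 0 R)"
    by (rule Cauchy_has_contour_integral_higher_derivative_circlepath)
       (use assms in \<open>auto intro!: continuous_intros holomorphic_intros\<close>)
  moreover have "(deriv ^^ j) (\<lambda>u. exp (u * z)) = (\<lambda>u. z ^ j * exp (u * z))" for j
  proof (induction j)
    case (Suc j)
    have "deriv (\<lambda>u. z ^ j * exp (u * z)) u = z ^ Suc j * exp (u * z)" for u
      by (rule DERIV_imp_deriv) (auto intro!: derivative_eq_intros)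
    then show ?case using Suc by auto
  qed simp
  ultimately have "((\<lambda>\<theta>. exp (circlepath 0 R \<theta> * z) / (circlepath 0 R \<theta>) ^ Suc k *
      vector_derivative (circlepath 0 R) (at \<theta>)) has_integral
      ((2 * pi * \<i>) / (fact k) * z ^ k)) {0..1}"
    unfolding has_contour_integral by simp
  also have "(\<lambda>\<theta>. exp (circlepath 0 R \<theta> * z) / (circlepath 0 R \<theta>) ^ Suc k *
      vector_derivative (circlepath 0 R) (at \<theta>)) =
      (\<lambda>\<theta>. (2 * pi * \<i>) * (exp (circlepath 0 R \<theta> * z) / circlepath 0 R \<theta> ^ k))"
  proof
    fix \<theta>
    have "vector_derivative (circlepath 0 R) (at \<theta>) = 2 * pi * \<i> * circlepath 0 R \<theta>"
      by (subst vector_derivative_circlepath) (simp add: circlepath)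
    moreover have "circlepath 0 R \<theta> \<noteq> 0"
      using cmod_circlepath_0[OF assms, of \<theta>] assms by auto
    ultimately show "exp (circlepath 0 R \<theta> * z) / (circlepath 0 R \<theta>) ^ Suc k *
        vector_derivative (circlepath 0 R) (at \<theta>) =
        (2 * pi * \<i>) * (exp (circlepath 0 R \<theta> * z) / circlepath 0 R \<theta> ^ k)"
      by simp
  qed
  finally have "((\<lambda>\<theta>. 1 / (2 * pi * \<i>) * ((2 * pi * \<i>) * (exp (circlepath 0 R \<theta> * z) / circlepath 0 R \<theta> ^ k)))
      has_integral 1 / (2 * pi * \<i>) * ((2 * pi * \<i>) / (fact k) * z ^ k)) {0..1}"
    by (rule has_integral_mult_right)
  then show ?thesis by simp
qed

lemma continuous_circlepath [continuous_intros]: "continuous_on A (circlepath z R)"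
  unfolding circlepath by (intro continuous_intros)

text \<open>The Borel transform. For \<open>F\<close> with coefficients \<open>b\<^sub>k / k!\<close> and type \<open>c\<close>, the series
  \<open>g = \<Sum>\<^sub>k b\<^sub>k / \<zeta>\<^sup>k\<close> converges uniformly on any circle of radius \<open>R > c\<close>, so it may be integrated
  against \<open>exp (\<zeta> * z)\<close> term by term. This writes \<open>F\<close> as a superposition of exponentials whose
  frequencies \<open>\<zeta>\<close> stay in a compact set.\<close>

lemma exponential_type_borel_representation:
  assumes "of_exponential_type F"
  obtains \<zeta> g :: "real \<Rightarrow> complex" where "continuous_on {0..1} \<zeta>" "continuous_on {0..1} g"
    "\<And>z. ((\<lambda>\<theta>. g \<theta> * exp (\<zeta> \<theta> * z)) has_integral F z) {0..1}"
proof -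
  obtain b c where F: "\<And>z. (\<lambda>k. b k / fact k * z ^ k) sums F z"
    and c: "(\<lambda>k. root k (cmod (b k))) \<longlonglongrightarrow> c"
    using assms unfolding of_exponential_type_def by blast
  have "c \<ge> 0"
    by (rule LIMSEQ_le_const[OF c]) (auto intro!: real_root_ge_zero)
  \<comment> \<open>The margin between \<open>c + 1\<close>, which eventually dominates the roots, and \<open>R\<close> gives a geometric
    series.\<close>
  define R where "R = c + 2"
  have R: "R > 0" using \<open>c \<ge> 0\<close> by (simp add: R_def)
  define q where "q = (c + 1) / R"
  have q: "0 \<le> q" "q < 1" using \<open>c \<ge> 0\<close> by (auto simp: q_def R_def field_simps)
  have "\<forall>\<^sub>F k in sequentially. root k (cmod (b k)) < c + 1"
    using c by (rule order_tendstoD) simp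
  then have bk: "\<forall>\<^sub>F k in sequentially. cmod (b k) / R ^ k \<le> q ^ k"
    using eventually_gt_at_top[of 0]
  proof eventually_elim
    case (elim k)
    then have "cmod (b k) = root k (cmod (b k)) ^ k" by simp
    also have "\<dots> \<le> (c + 1) ^ k"
      using elim by (intro power_mono) auto
    finally show ?case
      using R by (simp add: q_def power_divide divide_right_mono)
  qed
  define \<zeta> where "\<zeta> = circlepath 0 R"
  have \<zeta>: "cmod (\<zeta> \<theta>) = R" "\<zeta> \<theta> \<noteq> 0" for \<theta>
    using cmod_circlepath_0[OF R, of \<theta>] R unfolding \<zeta>_def by auto
  have \<zeta>c: "continuous_on {0..1} \<zeta>"
    unfolding \<zeta>_def by (intro continuous_intros)
  define g where "g \<theta> = (\<Sum>k. b k / \<zeta> \<theta> ^ k)" for \<theta>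
  have sum_q: "summable (\<lambda>k. q ^ k)"
    using q by (intro summable_geometric) auto
  have g_lim: "uniform_limit {0..1} (\<lambda>n \<theta>. \<Sum>k<n. b k / \<zeta> \<theta> ^ k) g sequentially"
    unfolding g_def
    by (rule Weierstrass_m_test_ev[OF _ sum_q])
       (use bk in eventually_elim, auto simp: norm_divide norm_power \<zeta>)
  have g: "continuous_on {0..1} g"
    by (rule uniform_limit_theorem[OF _ g_lim])
       (auto intro!: always_eventually continuous_intros \<zeta>c simp: \<zeta>)
  have "((\<lambda>\<theta>. g \<theta> * exp (\<zeta> \<theta> * z)) has_integral F z) {0..1}" for z
  proof -
    have e: "continuous_on {0..1} (\<lambda>\<theta>. exp (\<zeta> \<theta> * z))"
      by (intro continuous_intros \<zeta>c)
    have "uniform_limit {0..1} (\<lambda>n \<theta>. (\<Sum>k<n. b k / \<zeta> \<theta> ^ k) * exp (\<zeta> \<theta> * z))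
        (\<lambda>\<theta>. g \<theta> * exp (\<zeta> \<theta> * z)) sequentially"
      by (intro uniform_lim_mult g_lim uniform_limit_const compact_imp_bounded
           compact_continuous_image e g) auto
    then obtain I J where IJ: "\<And>n. ((\<lambda>\<theta>. (\<Sum>k<n. b k / \<zeta> \<theta> ^ k) * exp (\<zeta> \<theta> * z)) has_integral I n) {0..1}"
      "((\<lambda>\<theta>. g \<theta> * exp (\<zeta> \<theta> * z)) has_integral J) {0..1}" "I \<longlonglongrightarrow> J"
      by (rule uniform_limit_integral)
         (auto intro!: continuous_intros \<zeta>c simp: \<zeta>)
    have "((\<lambda>\<theta>. \<Sum>k<n. b k * (exp (\<zeta> \<theta> * z) / \<zeta> \<theta> ^ k)) has_integral (\<Sum>k<n. b k * (z ^ k / fact k))) {0..1}" for n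
      unfolding \<zeta>_def by (intro has_integral_sum has_integral_mult_right circle_integral_exp R) auto
    then have "((\<lambda>\<theta>. (\<Sum>k<n. b k / \<zeta> \<theta> ^ k) * exp (\<zeta> \<theta> * z)) has_integral (\<Sum>k<n. b k / fact k * z ^ k)) {0..1}" for n
      by (simp add: sum_distrib_left mult.commute)
    then have "I = (\<lambda>n. \<Sum>k<n. b k / fact k * z ^ k)"
      using IJ(1) has_integral_unique by blast
    then have "J = F z"
      using F[of z] IJ(3) LIMSEQ_unique unfolding sums_def by blast
    then show ?thesis using IJ(2) by simp
  qed
  then show ?thesis using that[OF \<zeta>c g] by blast
qed

section \<open>The generating function of one step\<close>

text \<open>A geometric series whose ratio is a root of unity different from \<open>1\<close>.\<close>

lemma root_power_average_zero: fixes j N :: nat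
  assumes "0 < j" "j < N"
  shows "(\<Sum>k<N. cis (2 * pi * real k / real N) ^ j) = 0"
proof -
  define w where "w = cis (2 * pi * real j / real N)"
  have "cis (2 * pi * real k / real N) ^ j = w ^ k" for k
    by (simp add: w_def Complex.DeMoivre algebra_simps)
  moreover have "w ^ N = 1"
    using assms by (simp add: w_def Complex.DeMoivre cis_multiple_2pi)
  moreover have "w \<noteq> 1"
  proof
    assume "w = 1"
    then have "exp (2 * of_real pi * \<i> * of_nat j / of_nat N) = 1"
      by (simp add: w_def cis_conv_exp algebra_simps)
    then show False
      using complex_root_unity_eq[of N j 0] assms by auto
  qed
  ultimately show ?thesis
    by (simp add: sum_gp_strict)
qed

text \<open>The value at \<open>\<mu>\<close> of the moment generating function of a variable that is uniform on the points
  \<open>a * cis (2 * pi * k / N)\<close>.\<close>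

definition avg_exp :: "nat \<Rightarrow> complex \<Rightarrow> complex \<Rightarrow> complex" where
  "avg_exp N a \<mu> = (\<Sum>k<N. exp (\<mu> * (a * cis (2 * pi * real k / real N)))) / of_nat N"

lemma sum_singletons_at_most: fixes h :: "nat \<Rightarrow> 'a::comm_monoid_add"
  assumes "N > 0" "\<And>j. 0 < j \<Longrightarrow> j < N \<Longrightarrow> h j = 0"
  shows "(\<Sum>j\<le>N. h j) = h 0 + h N"
proof -
  have "(\<Sum>j\<le>N. h j) = (\<Sum>j\<in>{0,N}. h j)"
    using assms by (intro sum.mono_neutral_right) auto
  then show ?thesis using assms by simp
qed

text \<open>Averaging over the \<open>N\<close>-th roots of unity kills every power that is not a multiple of \<open>N\<close>. Up to
  order \<open>N\<close> only the constant term and the \<open>N\<close>-th one survive, so a step of size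
  \<open>n\<close> to the power \<open>-1/N\<close> acts to leading order like \<open>1/n\<close> times an \<open>N\<close>-th derivative.\<close>

lemma avg_exp_taylor:
  assumes "N > 0"
  shows "cmod (avg_exp N a \<mu> - 1 - \<mu> ^ N * a ^ N / fact N)
    \<le> exp (cmod (\<mu> * a)) * cmod (\<mu> * a) ^ Suc N / fact N"
proof -
  define w where "w k = cis (2 * pi * real k / real N)" for k
  define z where "z k = \<mu> * (a * w k)" for k
  have z: "z k = \<mu> * a * w k" for k by (simp add: z_def)
  have wN: "w k ^ N = 1" for k
    using assms by (simp add: w_def Complex.DeMoivre cis_multiple_2pi)
  have "(\<Sum>k<N. \<Sum>j\<le>N. z k ^ j / fact j) = (\<Sum>j\<le>N. (\<mu> * a) ^ j / fact j * (\<Sum>k<N. w k ^ j))"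
    by (subst sum.swap) (simp add: z power_mult_distrib sum_distrib_left)
  also have "\<dots> = of_nat N + (\<mu> * a) ^ N / fact N * of_nat N"
    using assms root_power_average_zero
    by (subst sum_singletons_at_most) (auto simp: w_def wN[unfolded w_def])
  finally have poly: "(\<Sum>k<N. \<Sum>j\<le>N. z k ^ j / fact j) / of_nat N = 1 + \<mu> ^ N * a ^ N / fact N"
    using assms by (simp add: power_mult_distrib field_simps)
  have "avg_exp N a \<mu> - (1 + \<mu> ^ N * a ^ N / fact N)
      = (\<Sum>k<N. exp (z k) - (\<Sum>j\<le>N. z k ^ j / fact j)) / of_nat N"
    unfolding poly[symmetric] by (simp add: avg_exp_def z_def w_def sum_subtractf diff_divide_distrib)
  also have "cmod \<dots> \<le> (\<Sum>k<N. exp (cmod (\<mu> * a)) * cmod (\<mu> * a) ^ Suc N / fact N) / real N"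
  proof -
    have "cmod (exp (z k) - (\<Sum>j\<le>N. z k ^ j / fact j)) \<le> exp (cmod (\<mu> * a)) * cmod (\<mu> * a) ^ Suc N / fact N" for k
      using Taylor_exp_field[of "z k" N] by (simp add: z w_def norm_mult)
    then show ?thesis
      unfolding norm_divide norm_of_nat by (intro divide_right_mono sum_norm_le) auto
  qed
  finally show ?thesis using assms by (simp add: algebra_simps)
qed

section \<open>Expectations over the random walk\<close>

text \<open>As a finite sum, the expectation commutes with the integral over the frequencies by linearity.\<close>

lemma (in prob_space) expectation_finite_range:
  fixes X :: "'a \<Rightarrow> complex" and h :: "complex \<Rightarrow> complex"
  assumes V: "finite V" "AE \<omega> in M. X \<omega> \<in> V"
    and X[measurable]: "X \<in> borel_measurable M" and h[measurable]: "h \<in> borel_measurable borel"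
  shows "integrable M (\<lambda>\<omega>. h (X \<omega>))"
    and "expectation (\<lambda>\<omega>. h (X \<omega>)) = (\<Sum>v\<in>V. of_real (prob {\<omega> \<in> space M. X \<omega> = v}) * h v)"
proof -
  let ?A = "\<lambda>v. {\<omega> \<in> space M. X \<omega> = v}"
  have eq: "AE \<omega> in M. h (X \<omega>) = (\<Sum>v\<in>V. indicator (?A v) \<omega> *\<^sub>R h v)"
    using V(2)
  proof (rule AE_mp, intro AE_I2 impI)
    fix \<omega> assume "\<omega> \<in> space M" "X \<omega> \<in> V"
    then have "(\<Sum>v\<in>V. indicator (?A v) \<omega> *\<^sub>R h v) = (\<Sum>v\<in>V. if v = X \<omega> then h v else 0)"
      by (intro sum.cong) auto
    then show "h (X \<omega>) = (\<Sum>v\<in>V. indicator (?A v) \<omega> *\<^sub>R h v)"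
      using V(1) \<open>X \<omega> \<in> V\<close> by simp
  qed
  have "has_bochner_integral M (\<lambda>\<omega>. \<Sum>v\<in>V. indicator (?A v) \<omega> *\<^sub>R h v) (\<Sum>v\<in>V. prob (?A v) *\<^sub>R h v)"
    by (intro has_bochner_integral_sum has_bochner_integral_indicator) (auto simp: emeasure_eq_measure)
  then have "has_bochner_integral M (\<lambda>\<omega>. h (X \<omega>)) (\<Sum>v\<in>V. prob (?A v) *\<^sub>R h v)"
    using eq by (subst has_bochner_integral_cong_AE) auto
  then show "integrable M (\<lambda>\<omega>. h (X \<omega>))"
    and "expectation (\<lambda>\<omega>. h (X \<omega>)) = (\<Sum>v\<in>V. of_real (prob (?A v)) * h v)"
    by (auto simp: has_bochner_integral_iff scaleR_conv_of_real)
qed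

lemma finite_scaled_roots_of_unity: "finite (scaled_roots_of_unity N a)"
  by (simp add: scaled_roots_of_unity_def)

text \<open>For \<open>a = 0\<close> the points coincide and the set is a singleton, yet the average over the set agrees
  with the average over the \<open>N\<close> indices.\<close>

lemma sum_scaled_roots_of_unity:
  fixes h :: "complex \<Rightarrow> complex"
  assumes "N > 0"
  shows "(\<Sum>s\<in>scaled_roots_of_unity N a. h s) / of_nat (card (scaled_roots_of_unity N a))
    = (\<Sum>k<N. h (a * cis (2 * pi * real k / real N))) / of_nat N"
proof (cases "a = 0")
  case True
  then have "scaled_roots_of_unity N a = {0}"
    using assms by (auto simp: scaled_roots_of_unity_def)
  then show ?thesis using True assms by simp
next
  case False
  have "inj_on (\<lambda>k. cis (2 * pi * real k / real N)) {..<N}"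
    using Complex.bij_betw_roots_unity[OF assms] by (rule bij_betw_imp_inj_on)
  then have inj: "inj_on (\<lambda>k. a * cis (2 * pi * real k / real N)) {..<N}"
    using False by (auto simp: inj_on_def)
  then show ?thesis
    unfolding scaled_roots_of_unity_def by (simp add: sum.reindex card_image)
qed

lemma uniform_scaled_root:
  assumes "N > 0" and X: "uniformly_distributed_on M X (scaled_roots_of_unity N a)"
  shows "AE \<omega> in M. X \<omega> \<in> scaled_roots_of_unity N a"
    and "h \<in> borel_measurable borel \<Longrightarrow>
      integral\<^sup>L M (\<lambda>\<omega>. h (X \<omega>)) = (\<Sum>k<N. h (a * cis (2 * pi * real k / real N))) / (of_nat N :: complex)"
proof -
  let ?S = "scaled_roots_of_unity N a"
  have X_meas[measurable]: "X \<in> borel_measurable M"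
    and distr: "distr M borel X = distr (uniform_count_measure ?S) borel (\<lambda>z. z)"
    using X by (auto simp: uniformly_distributed_on_def)
  have id_meas[measurable]: "(\<lambda>z. z) \<in> borel_measurable (uniform_count_measure ?S)"
    by (simp add: measurable_def space_uniform_count_measure sets_uniform_count_measure)
  have S_sets[measurable]: "?S \<in> sets borel"
    using finite_scaled_roots_of_unity by (intro borel_closed finite_imp_closed)
  have "AE z in distr (uniform_count_measure ?S) borel (\<lambda>z. z). z \<in> ?S"
    by (subst AE_distr_iff) (auto intro!: AE_I2 simp: space_uniform_count_measure)
  then show "AE \<omega> in M. X \<omega> \<in> ?S"
    unfolding distr[symmetric] by (subst (asm) AE_distr_iff) auto
  assume [measurable]: "h \<in> borel_measurable borel"
  have "integral\<^sup>L M (\<lambda>\<omega>. h (X \<omega>)) = integral\<^sup>L (distr M borel X) h"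
    by (rule integral_distr[symmetric]) auto
  also have "\<dots> = integral\<^sup>L (uniform_count_measure ?S) h"
    unfolding distr by (rule integral_distr) auto
  also have "\<dots> = (\<Sum>s\<in>?S. h s) / of_nat (card ?S)"
    unfolding uniform_count_measure_def
    by (subst lebesgue_integral_point_measure_finite)
       (auto simp: finite_scaled_roots_of_unity sum_divide_distrib scaleR_conv_of_real)
  finally show "integral\<^sup>L M (\<lambda>\<omega>. h (X \<omega>)) = (\<Sum>k<N. h (a * cis (2 * pi * real k / real N))) / of_nat N"
    by (simp add: sum_scaled_roots_of_unity assms(1))
qed

context prob_space
begin

context
  fixes \<xi> :: "nat \<Rightarrow> 'a \<Rightarrow> complex" and N :: nat and a :: complex
  assumes N: "N > 0" and iid: "iid_uniform M \<xi> (scaled_roots_of_unity N a)"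
begin

lemma iid_measurable [measurable]: "\<xi> (Suc k) \<in> borel_measurable M"
  using iid by (auto simp: iid_uniform_def uniformly_distributed_on_def)

lemma AE_weighted_sum_finite_range:
  "\<exists>V. finite V \<and> (AE \<omega> in M. (\<Sum>\<tau><m. c \<tau> * \<xi> (Suc \<tau>) \<omega>) \<in> V)"
proof (induction m)
  case 0
  then show ?case by (intro exI[of _ "{0}"]) simp
next
  case (Suc m)
  then obtain V where V: "finite V" "AE \<omega> in M. (\<Sum>\<tau><m. c \<tau> * \<xi> (Suc \<tau>) \<omega>) \<in> V" by auto
  let ?S = "scaled_roots_of_unity N a"
  have "AE \<omega> in M. \<xi> (Suc m) \<omega> \<in> ?S"
    using iid by (intro uniform_scaled_root(1)[OF N]) (auto simp: iid_uniform_def)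
  with V(2) have "AE \<omega> in M. (\<Sum>\<tau><Suc m. c \<tau> * \<xi> (Suc \<tau>) \<omega>) \<in> (\<lambda>(v, s). v + c m * s) ` (V \<times> ?S)"
    by eventually_elim (auto simp: image_iff)
  moreover have "finite ((\<lambda>(v, s). v + c m * s) ` (V \<times> ?S))"
    using V(1) finite_scaled_roots_of_unity by simp
  ultimately show ?case
    by (intro exI conjI)
qed

text \<open>Independence turns the exponential of the sum into a product of generating functions.\<close>

lemma expectation_exp_weighted_sum:
  "expectation (\<lambda>\<omega>. exp (w * (\<Sum>\<tau><m. c \<tau> * \<xi> (Suc \<tau>) \<omega>))) = (\<Prod>\<tau><m. avg_exp N a (w * c \<tau>))"
proof -
  define Y where "Y k \<omega> = exp (w * c (k - 1) * \<xi> k \<omega>)" for k \<omega>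
  have unif: "uniformly_distributed_on M (\<xi> k) (scaled_roots_of_unity N a)" if "k \<ge> 1" for k
    using iid that by (auto simp: iid_uniform_def)
  have meas: "(\<lambda>z. exp (\<mu> * z)) \<in> borel_measurable borel" for \<mu> :: complex
    by (intro borel_measurable_continuous_onI continuous_intros)
  have "indep_vars (\<lambda>_. borel) \<xi> {1..}"
    using iid unfolding iid_uniform_def by (rule conjunct1)
  then have "indep_vars (\<lambda>_. borel) \<xi> {1..m}"
    by (rule indep_vars_subset) auto
  then have "indep_vars (\<lambda>_. borel) Y {1..m}"
    unfolding Y_def[abs_def] by (rule indep_vars_compose2) (rule meas)
  moreover have "integrable M (Y k)" if "k \<in> {1..m}" for k
  proof -
    have k: "uniformly_distributed_on M (\<xi> k) (scaled_roots_of_unity N a)"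
      using that unif by simp
    then have "\<xi> k \<in> borel_measurable M"
      by (simp add: uniformly_distributed_on_def)
    from expectation_finite_range(1)[OF finite_scaled_roots_of_unity uniform_scaled_root(1)[OF N k] this meas]
    show ?thesis
      unfolding Y_def .
  qed
  ultimately have "expectation (\<lambda>\<omega>. \<Prod>k\<in>{1..m}. Y k \<omega>) = (\<Prod>k\<in>{1..m}. expectation (Y k))"
    by (intro indep_vars_lebesgue_integral) auto
  moreover have "(\<Prod>k\<in>{1..m}. Y k \<omega>) = exp (w * (\<Sum>\<tau><m. c \<tau> * \<xi> (Suc \<tau>) \<omega>))" for \<omega>
    by (simp add: prod.atLeast1_atMost_eq Y_def exp_sum sum_distrib_left mult.assoc)
  moreover have "expectation (Y k) = avg_exp N a (w * c (k - 1))" if "k \<ge> 1" for k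
    unfolding Y_def[abs_def] avg_exp_def
    using uniform_scaled_root(2)[OF N unif[OF that] meas] by simp
  ultimately show ?thesis
    by (simp add: prod.atLeast1_atMost_eq)
qed

text \<open>By linearity it suffices to average each exponential in the representation of \<open>F\<close>; this reduces
  the expectation for a general \<open>F\<close> to the explicit product above.\<close>

lemma expectation_exponential_transform:
  fixes g \<zeta> :: "real \<Rightarrow> complex"
  assumes g: "continuous_on {0..1} g" and \<zeta>: "continuous_on {0..1} \<zeta>"
    and F: "\<And>z. ((\<lambda>\<theta>. g \<theta> * exp (\<zeta> \<theta> * z)) has_integral F z) {0..1}"
  shows "((\<lambda>\<theta>. g \<theta> * exp (\<zeta> \<theta> * x) * (\<Prod>\<tau><m. avg_exp N a (\<zeta> \<theta> * c \<tau>))) has_integral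
     expectation (\<lambda>\<omega>. F (x + (\<Sum>\<tau><m. c \<tau> * \<xi> (Suc \<tau>) \<omega>)))) {0..1}"
proof -
  define S where "S \<omega> = (\<Sum>\<tau><m. c \<tau> * \<xi> (Suc \<tau>) \<omega>)" for \<omega>
  obtain V where V: "finite V" "AE \<omega> in M. S \<omega> \<in> V"
    unfolding S_def using AE_weighted_sum_finite_range by blast
  have S: "S \<in> borel_measurable M"
    unfolding S_def[abs_def] by measurable
  define p where "p v = prob {\<omega> \<in> space M. S \<omega> = v}" for v
  \<comment> \<open>\<open>F\<close> inherits continuity, hence measurability, from its integral representation.\<close>
  have "continuous_on (UNIV \<times> cbox 0 (1::real)) (\<lambda>q. g (snd q))"
    "continuous_on (UNIV \<times> cbox 0 (1::real)) (\<lambda>q. \<zeta> (snd q))"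
    by (auto intro!: continuous_on_compose2[OF g] continuous_on_compose2[OF \<zeta>] continuous_intros)
  then have "continuous_on (UNIV \<times> cbox 0 1) (\<lambda>(z, \<theta>). g \<theta> * exp (\<zeta> \<theta> * z))"
    unfolding split_beta by (intro continuous_intros)
  then have "continuous_on UNIV (\<lambda>z. integral (cbox 0 1) (\<lambda>\<theta>. g \<theta> * exp (\<zeta> \<theta> * z)))"
    by (rule integral_continuous_on_param)
  also have "(\<lambda>z. integral (cbox 0 1) (\<lambda>\<theta>. g \<theta> * exp (\<zeta> \<theta> * z))) = F"
    using integral_unique[OF F] by (simp add: fun_eq_iff)
  finally have F_cont: "continuous_on UNIV F" .
  have h: "(\<lambda>v. F (x + v)) \<in> borel_measurable borel"
    by (intro borel_measurable_continuous_onI continuous_on_compose2[OF F_cont] continuous_intros) auto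
  have e: "(\<lambda>v. exp (w * v)) \<in> borel_measurable borel" for w :: complex
    by (intro borel_measurable_continuous_onI continuous_intros)
  have "((\<lambda>\<theta>. \<Sum>v\<in>V. of_real (p v) * (g \<theta> * exp (\<zeta> \<theta> * (x + v)))) has_integral
      (\<Sum>v\<in>V. of_real (p v) * F (x + v))) {0..1}"
    by (intro has_integral_sum V has_integral_mult_right F)
  also have "(\<Sum>v\<in>V. of_real (p v) * F (x + v)) = expectation (\<lambda>\<omega>. F (x + S \<omega>))"
    unfolding p_def by (rule expectation_finite_range(2)[OF V S h, symmetric])
  also have "(\<lambda>\<theta>. \<Sum>v\<in>V. of_real (p v) * (g \<theta> * exp (\<zeta> \<theta> * (x + v)))) =
      (\<lambda>\<theta>. g \<theta> * exp (\<zeta> \<theta> * x) * (\<Prod>\<tau><m. avg_exp N a (\<zeta> \<theta> * c \<tau>)))"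
  proof
    fix \<theta>
    have "(\<Sum>v\<in>V. of_real (p v) * (g \<theta> * exp (\<zeta> \<theta> * (x + v)))) =
        g \<theta> * exp (\<zeta> \<theta> * x) * (\<Sum>v\<in>V. of_real (p v) * exp (\<zeta> \<theta> * v))"
      by (simp add: sum_distrib_left distrib_left exp_add mult_ac)
    also have "(\<Sum>v\<in>V. of_real (p v) * exp (\<zeta> \<theta> * v)) = expectation (\<lambda>\<omega>. exp (\<zeta> \<theta> * S \<omega>))"
      unfolding p_def by (rule expectation_finite_range(2)[OF V S e, symmetric])
    finally show "(\<Sum>v\<in>V. of_real (p v) * (g \<theta> * exp (\<zeta> \<theta> * (x + v)))) =
        g \<theta> * exp (\<zeta> \<theta> * x) * (\<Prod>\<tau><m. avg_exp N a (\<zeta> \<theta> * c \<tau>))"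
      unfolding S_def by (simp only: expectation_exp_weighted_sum)
  qed
  finally show ?thesis
    unfolding S_def .
qed

end

end

section \<open>Convergence of the generating functions\<close>

text \<open>Replacing the factors one at a time, each replacement costs the distance of the two factors times
  the other \<open>m - 1\<close> factors, at most \<open>K ^ (m - 1) \<le> K ^ m\<close>.\<close>

lemma norm_prod_diff_le:
  fixes z w :: "nat \<Rightarrow> 'b::real_normed_field"
  assumes "K \<ge> 1" "\<And>i. i < m \<Longrightarrow> norm (z i) \<le> K" "\<And>i. i < m \<Longrightarrow> norm (w i) \<le> K"
  shows "norm ((\<Prod>i<m. z i) - (\<Prod>i<m. w i)) \<le> K ^ m * (\<Sum>i<m. norm (z i - w i))"
  using assms(2,3)
proof (induction m)
  case (Suc m)
  let ?Z = "\<Prod>i<m. z i" and ?W = "\<Prod>i<m. w i" and ?s = "\<Sum>i<m. norm (z i - w i)"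
  have W: "norm ?W \<le> K ^ m"
  proof -
    have "norm ?W \<le> (\<Prod>i<m. K)"
      unfolding prod_norm[symmetric] using Suc.prems by (intro prod_mono) auto
    then show ?thesis by simp
  qed
  have s: "0 \<le> ?s"
    by (rule sum_nonneg) simp
  have "(\<Prod>i<Suc m. z i) - (\<Prod>i<Suc m. w i) = (?Z - ?W) * z m + ?W * (z m - w m)"
    by (simp add: algebra_simps)
  also have "norm \<dots> \<le> norm (?Z - ?W) * norm (z m) + norm ?W * norm (z m - w m)"
    by (metis norm_mult norm_triangle_ineq)
  also have "\<dots> \<le> (K ^ m * ?s) * K + K ^ m * norm (z m - w m)"
    using Suc assms(1) W by (intro add_mono mult_mono) (auto intro: mult_nonneg_nonneg s)
  also have "\<dots> \<le> (K ^ m * ?s) * K + (K ^ m * K) * norm (z m - w m)"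
    using assms(1) by (intro add_mono mult_right_mono order_refl)
      (auto simp: mult_le_cancel_left1)
  finally show ?case by (simp add: algebra_simps)
qed simp

text \<open>On a full cell \<open>\<psi>\<close> oscillates by less than \<open>e\<close> once the mesh \<open>1 / n\<close> is small, so the error there
  is at most \<open>e / n\<close>; the unfinished last cell contributes at most \<open>B / n\<close> if \<open>B\<close> bounds \<open>\<psi>\<close>.\<close>

lemma riemann_sum_tendsto_integral:
  fixes \<psi> :: "real \<Rightarrow> complex"
  assumes \<psi>: "continuous_on {0..T} \<psi>" and t: "t \<in> {0..T}"
  shows "(\<lambda>n. \<Sum>\<tau><nat \<lfloor>real n * t\<rfloor>. \<psi> (real \<tau> / real n) / of_nat n) \<longlonglongrightarrow> integral {0..t} \<psi>"
proof (rule LIMSEQ_I)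
  define I where "I s = integral {0..s} \<psi>" for s
  have I_diff: "cmod (I d - I c - of_real (d - c) * w) \<le> e * (d - c)"
    if "0 \<le> c" "c \<le> d" "d \<le> T" and e: "\<And>s. s \<in> {c..d} \<Longrightarrow> cmod (\<psi> s - w) \<le> e" for c d w e
  proof -
    have cont: "continuous_on {c..d} \<psi>" "continuous_on {0..d} \<psi>"
      using that by (auto intro: continuous_on_subset[OF \<psi>])
    have "I c + integral {c..d} \<psi> = I d"
      unfolding I_def using that by (intro Henstock_Kurzweil_Integration.integral_combine integrable_continuous_real cont)
    moreover have "integral {c..d} (\<lambda>s. \<psi> s - w) = integral {c..d} \<psi> - of_real (d - c) * w"
      using that cont by (subst integral_diff) (auto intro!: integrable_continuous_real simp: scaleR_conv_of_real)
    ultimately have "I d - I c - of_real (d - c) * w = integral {c..d} (\<lambda>s. \<psi> s - w)"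
      by (simp add: algebra_simps)
    then show ?thesis
      using that cont by (auto intro!: integral_bound continuous_intros)
  qed
  have "compact (\<psi> ` {0..T})"
    using \<psi> by (intro compact_continuous_image) auto
  then obtain B where B: "B > 0" "\<And>s. s \<in> {0..T} \<Longrightarrow> cmod (\<psi> s) \<le> B"
    using compact_imp_bounded[of "\<psi> ` {0..T}"] by (auto simp: bounded_pos)
  fix \<epsilon> :: real assume "\<epsilon> > 0"
  define e where "e = \<epsilon> / (2 * (T + 1))"
  have T: "T \<ge> 0" using t by auto
  have e: "e > 0" "e * T < \<epsilon> / 2"
    using \<open>\<epsilon> > 0\<close> T by (auto simp: e_def field_simps)
  have "uniformly_continuous_on {0..T} \<psi>"
    using \<psi> by (intro compact_uniformly_continuous) auto
  then obtain \<delta> where \<delta>: "\<delta> > 0" "\<And>s s'. s \<in> {0..T} \<Longrightarrow> s' \<in> {0..T} \<Longrightarrow> dist s' s < \<delta> \<Longrightarrow> dist (\<psi> s') (\<psi> s) < e"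
    using e(1) unfolding uniformly_continuous_on_def by metis
  obtain n0 :: nat where n0: "real n0 > max (1 / \<delta>) (2 * B / \<epsilon>)"
    using reals_Archimedean2 by blast
  have "norm ((\<Sum>\<tau><nat \<lfloor>real n * t\<rfloor>. \<psi> (real \<tau> / real n) / of_nat n) - I t) < \<epsilon>" if "n \<ge> n0" for n
  proof -
    have "1 / \<delta> < real n" "2 * B / \<epsilon> < real n" using n0 that by auto
    moreover from this \<open>\<delta> > 0\<close> have n: "n > 0"
      by (metis divide_pos_pos less_trans of_nat_0_less_iff zero_less_one)
    ultimately have n\<delta>: "1 / real n < \<delta>" and nB: "B / real n < \<epsilon> / 2"
      using \<open>\<delta> > 0\<close> \<open>\<epsilon> > 0\<close> by (auto simp: field_simps)
    have part: "cmod (I (real m / real n) - (\<Sum>\<tau><m. \<psi> (real \<tau> / real n) / of_nat n)) \<le> e * (real m / real n)"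
      if "real m / real n \<le> T" for m
      using that
    proof (induction m)
      case 0
      then show ?case by (simp add: I_def)
    next
      case (Suc m)
      let ?c = "real m / real n" and ?d = "real (Suc m) / real n" and ?s = "\<Sum>\<tau><m. \<psi> (real \<tau> / real n) / of_nat n"
      have cd: "0 \<le> ?c" "?c \<le> ?d" "?d - ?c = 1 / real n"
        using n by (auto simp: field_simps)
      have "cmod (I ?d - I ?c - of_real (?d - ?c) * \<psi> ?c) \<le> e * (?d - ?c)"
      proof (rule I_diff)
        fix s assume s: "s \<in> {?c..?d}"
        then have "?c \<le> s" "s \<le> ?d" by auto
        then have "?c \<in> {0..T}" "s \<in> {0..T}" "dist s ?c < \<delta>"
          using cd Suc.prems n\<delta> unfolding atLeastAtMost_iff dist_real_def by linarith+
        then have "dist (\<psi> s) (\<psi> ?c) < e"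
          by (rule \<delta>(2))
        then show "cmod (\<psi> s - \<psi> ?c) \<le> e" by (simp add: dist_norm)
      qed (use cd Suc.prems in auto)
      moreover have "cmod (I ?c - ?s) \<le> e * ?c"
        using Suc cd by auto
      moreover have "I ?d - (\<Sum>\<tau><Suc m. \<psi> (real \<tau> / real n) / of_nat n) =
          (I ?d - I ?c - of_real (?d - ?c) * \<psi> ?c) + (I ?c - ?s)"
        unfolding cd(3) by simp
      ultimately have "cmod (I ?d - (\<Sum>\<tau><Suc m. \<psi> (real \<tau> / real n) / of_nat n)) \<le> e * (?d - ?c) + e * ?c"
        using norm_triangle_ineq by (smt (verit))
      then show ?case by (simp add: algebra_simps)
    qed
    define m where "m = nat \<lfloor>real n * t\<rfloor>"
    have nt: "real n * t \<ge> 0" using t by auto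
    have m: "real m \<le> real n * t" "real n * t < real m + 1"
      unfolding m_def using nt by (auto simp: of_nat_nat)
    have mt: "real m / real n \<le> t" "t - real m / real n \<le> 1 / real n"
      proof -
      show "real m / real n \<le> t" using m(1) n by (simp add: field_simps)
      have "t \<le> (real m + 1) / real n" using m(2) n by (simp add: field_simps)
      then show "t - real m / real n \<le> 1 / real n" by (simp add: add_divide_distrib)
    qed
    have "cmod (I (real m / real n) - (\<Sum>\<tau><m. \<psi> (real \<tau> / real n) / of_nat n)) \<le> e * (real m / real n)"
      using part mt t by auto
    also have "\<dots> \<le> e * T"
      using e mt t by (intro mult_left_mono) auto
    also have "\<dots> < \<epsilon> / 2" by (rule e)
    finally have 1: "cmod (I (real m / real n) - (\<Sum>\<tau><m. \<psi> (real \<tau> / real n) / of_nat n)) < \<epsilon> / 2" .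
    have "cmod (I t - I (real m / real n)) \<le> B * (t - real m / real n)"
    proof -
      have "cmod (\<psi> s - 0) \<le> B" if "s \<in> {real m / real n..t}" for s
      proof -
        have "0 \<le> real m / real n" by simp
        then have "s \<in> {0..T}" using that t unfolding atLeastAtMost_iff by linarith
        then show ?thesis using B(2) by simp
      qed
      from I_diff[OF _ mt(1) _ this] show ?thesis using t by simp
    qed
    also have "\<dots> \<le> B * (1 / real n)"
      using B mt by (intro mult_left_mono) auto
    also have "\<dots> < \<epsilon> / 2"
      using nB by simp
    finally have "cmod (I t - I (real m / real n)) < \<epsilon> / 2" .
    with 1 have "cmod ((I (real m / real n) - (\<Sum>\<tau><m. \<psi> (real \<tau> / real n) / of_nat n)) + (I t - I (real m / real n))) < \<epsilon>"
      using norm_triangle_ineq by (smt (verit) field_sum_of_halves)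
    then show ?thesis
      unfolding m_def[symmetric] by (simp add: norm_minus_commute)
  qed
  then show "\<exists>n0. \<forall>n\<ge>n0. norm ((\<Sum>\<tau><nat \<lfloor>real n * t\<rfloor>. \<psi> (real \<tau> / real n) / of_nat n) - integral {0..t} \<psi>) < \<epsilon>"
    unfolding I_def by blast
qed

text \<open>With \<open>\<mu>\<close> of the size of a single step, \<open>v\<close> is of order \<open>1 / n\<close>. The generating function and
  \<open>exp v\<close> share the expansion \<open>1 + v\<close>; the remainders are of order \<open>N + 1\<close> in \<open>\<mu>\<close> and of order \<open>2\<close> in
  \<open>v\<close>. Both are \<open>o(1 / n)\<close>, which is what the comparison of products with about \<open>n\<close> factors
  requires. The bounds by \<open>exp (C\<^sub>1 / n)\<close> keep such products bounded.\<close>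

lemma avg_exp_estimates:
  fixes N n :: nat and L :: real
  assumes N: "N > 0" and n: "n > 0" and L: "cmod (\<mu> * a) \<le> L / root N (real n)"
  defines "C\<^sub>1 \<equiv> L ^ N + exp L * L ^ Suc N" and "C\<^sub>2 \<equiv> exp L * L ^ Suc N + exp (L ^ N) * (L ^ N)\<^sup>2"
    and "v \<equiv> \<mu> ^ N * a ^ N / fact N"
  shows "cmod (avg_exp N a \<mu>) \<le> exp (C\<^sub>1 / real n)" "cmod (exp v) \<le> exp (C\<^sub>1 / real n)"
    "cmod (avg_exp N a \<mu> - exp v) \<le> C\<^sub>2 / (real n * root N (real n))"
proof -
  define r where "r = root N (real n)"
  define y where "y = cmod (\<mu> * a)"
  have r: "r \<ge> 1" "r ^ N = real n"
    using N n by (auto simp: r_def)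
  have rn: "r \<le> real n"
    using r self_le_power[of r N] N by simp
  have y: "0 \<le> y" "y \<le> L / r" using L by (auto simp: y_def r_def)
  have L0: "L \<ge> 0" using y r(1) by (smt (verit) divide_neg_pos)
  have "L / r \<le> L" using L0 r(1) by (simp add: field_simps mult_le_cancel_left1)
  then have yL: "y \<le> L" using y by simp
  have "y ^ N \<le> (L / r) ^ N" using y by (intro power_mono) auto
  then have yN: "y ^ N \<le> L ^ N / real n" by (simp add: power_divide r)
  have LN: "0 \<le> L ^ N" using L0 by simp
  have f1: "(1::real) \<le> fact N" by (rule fact_ge_1)
  have "cmod v = y ^ N / fact N"
    by (simp add: v_def y_def norm_divide norm_mult norm_power power_mult_distrib)
  also have "\<dots> \<le> y ^ N"
    using mult_right_mono[OF f1, of "y ^ N"] y(1) by (simp add: field_simps)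
  finally have v: "cmod v \<le> L ^ N / real n" using yN by simp
  have vL: "cmod v \<le> L ^ N"
  proof -
    have "L ^ N / real n \<le> L ^ N" using frac_le[OF LN order_refl, of 1 "real n"] n by simp
    then show ?thesis using v by simp
  qed
  have "cmod (avg_exp N a \<mu> - 1 - v) \<le> exp y * y ^ Suc N / fact N"
    using avg_exp_taylor[OF N, of a \<mu>] by (simp add: v_def y_def)
  also have "\<dots> \<le> exp y * y ^ Suc N"
    using mult_right_mono[OF f1, of "exp y * y ^ Suc N"] y(1) by (simp add: field_simps)
  also have "\<dots> \<le> exp L * (L ^ N / real n * (L / r))"
    unfolding power_Suc2 using y yL yN LN by (intro mult_mono) auto
  also have "\<dots> = exp L * L ^ Suc N / (real n * r)" by (simp add: field_simps)
  finally have 1: "cmod (avg_exp N a \<mu> - 1 - v) \<le> exp L * L ^ Suc N / (real n * r)" .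
  have "cmod (exp v - (\<Sum>i\<le>1. v ^ i / fact i)) \<le> exp (cmod v) * cmod v ^ Suc 1 / fact 1"
    by (rule Taylor_exp_field)
  then have "cmod (exp v - 1 - v) \<le> exp (cmod v) * (cmod v)\<^sup>2"
    by (simp add: algebra_simps power2_eq_square)
  also have "\<dots> \<le> exp (L ^ N) * (L ^ N / real n)\<^sup>2"
    using v vL by (intro mult_mono power_mono) auto
  also have "\<dots> = exp (L ^ N) * (L ^ N)\<^sup>2 / (real n * real n)"
    by (simp add: power_divide power2_eq_square)
  also have "\<dots> \<le> exp (L ^ N) * (L ^ N)\<^sup>2 / (real n * r)"
    using rn r n by (intro divide_left_mono mult_left_mono mult_pos_pos) auto
  finally have 2: "cmod (exp v - 1 - v) \<le> exp (L ^ N) * (L ^ N)\<^sup>2 / (real n * r)" .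
  have "avg_exp N a \<mu> - exp v = (avg_exp N a \<mu> - 1 - v) - (exp v - 1 - v)" by simp
  then have "cmod (avg_exp N a \<mu> - exp v) \<le> cmod (avg_exp N a \<mu> - 1 - v) + cmod (exp v - 1 - v)"
    by (metis norm_triangle_ineq4)
  with 1 2 show "cmod (avg_exp N a \<mu> - exp v) \<le> C\<^sub>2 / (real n * root N (real n))"
    unfolding C\<^sub>2_def r_def[symmetric] by (simp add: add_divide_distrib)
  have LS: "0 \<le> exp L * L ^ Suc N" using L0 by simp
  have "exp L * L ^ Suc N / (real n * r) \<le> exp L * L ^ Suc N / real n"
    using r n LS by (intro divide_left_mono) (auto simp: mult_le_cancel_left1)
  moreover have "avg_exp N a \<mu> = 1 + v + (avg_exp N a \<mu> - 1 - v)" by simp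
  then have "cmod (avg_exp N a \<mu>) \<le> 1 + cmod v + cmod (avg_exp N a \<mu> - 1 - v)"
    by (metis norm_triangle_mono norm_one norm_triangle_ineq order_refl)
  ultimately have "cmod (avg_exp N a \<mu>) \<le> 1 + C\<^sub>1 / real n"
    using 1 v by (simp add: C\<^sub>1_def add_divide_distrib)
  also have "\<dots> \<le> exp (C\<^sub>1 / real n)" by (rule exp_ge_add_one_self)
  finally show "cmod (avg_exp N a \<mu>) \<le> exp (C\<^sub>1 / real n)" .
  have "cmod (exp v) \<le> exp (cmod v)" by (rule norm_exp)
  also have "\<dots> \<le> exp (C\<^sub>1 / real n)"
    using v LS n by (auto simp: C\<^sub>1_def add_divide_distrib intro: order_trans)
  finally show "cmod (exp v) \<le> exp (C\<^sub>1 / real n)" .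
qed

text \<open>Each factor may be replaced by the exponential of its leading term, after which the product is the
  exponential of a Riemann sum for the integral of \<open>\<phi>\<^sup>N\<close>. The second claim is the uniform bound over
  bounded frequencies that dominated convergence needs.\<close>

lemma prod_avg_exp_limit:
  fixes N :: nat
  assumes N: "N > 0" and \<phi>: "continuous_on {0..T} \<phi>" and t: "t \<in> {0..T}"
  shows "(\<lambda>n. \<Prod>\<tau><nat \<lfloor>real n * t\<rfloor>. avg_exp N a (w * (\<phi> (real \<tau> / real n) / of_real (root N (real n)))))
      \<longlonglongrightarrow> exp (integral {0..t} (\<lambda>s. a ^ N / fact N * \<phi> s ^ N) * w ^ N)" (is "?P \<longlonglongrightarrow> _")
    and "\<exists>C. \<forall>n w. cmod w \<le> R \<longrightarrow>
      cmod (\<Prod>\<tau><nat \<lfloor>real n * t\<rfloor>. avg_exp N a (w * (\<phi> (real \<tau> / real n) / of_real (root N (real n))))) \<le> C"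
proof -
  have "compact (\<phi> ` {0..T})"
    using \<phi> by (intro compact_continuous_image) auto
  then obtain B where B: "B > 0" "\<And>s. s \<in> {0..T} \<Longrightarrow> cmod (\<phi> s) \<le> B"
    using compact_imp_bounded[of "\<phi> ` {0..T}"] by (auto simp: bounded_pos)
  define m where "m n = nat \<lfloor>real n * t\<rfloor>" for n
  define \<mu> where "\<mu> w n \<tau> = w * (\<phi> (real \<tau> / real n) / of_real (root N (real n)))" for w n \<tau>
  have m_le: "real (m n) \<le> real n * T" for n
  proof -
    have "real (m n) \<le> real n * t" using t by (auto simp: m_def of_nat_nat)
    also have "\<dots> \<le> real n * T" using t by (intro mult_left_mono) auto
    finally show ?thesis .
  qed
  have \<mu>: "cmod (\<mu> w n \<tau> * a) \<le> (R * B * cmod a) / root N (real n)"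
    if w: "cmod w \<le> R" and n: "n > 0" and "\<tau> < m n" for n \<tau> w R
  proof -
    have "real \<tau> \<le> real n * T" using that m_le[of n] by linarith
    then have "cmod (\<phi> (real \<tau> / real n)) \<le> B"
      using n by (intro B) (auto simp: field_simps)
    then have "cmod w * cmod (\<phi> (real \<tau> / real n)) * cmod a \<le> R * B * cmod a"
      using w B(1) by (intro mult_right_mono mult_mono) (auto intro: order_trans[OF norm_ge_zero])
    then show ?thesis
      using n N by (simp add: \<mu>_def norm_mult norm_divide divide_right_mono)
  qed
  have K_pow: "exp (C / real n) ^ m n \<le> exp (C * T)" if "C \<ge> 0" "n > 0" for C n
  proof -
    have "real (m n) * (C / real n) = C * (real (m n) / real n)" by simp
    also have "\<dots> \<le> C * T"
      using m_le[of n] that by (intro mult_left_mono) (auto simp: field_simps)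
    finally show ?thesis by (simp add: exp_of_nat_mult[symmetric])
  qed
  show "\<exists>C. \<forall>n w. cmod w \<le> R \<longrightarrow>
      cmod (\<Prod>\<tau><nat \<lfloor>real n * t\<rfloor>. avg_exp N a (w * (\<phi> (real \<tau> / real n) / of_real (root N (real n))))) \<le> C"
  proof (intro exI allI impI)
    fix n w assume w: "cmod w \<le> R"
    define L where "L = R * B * cmod a"
    define C where "C = L ^ N + exp L * L ^ Suc N"
    have "R \<ge> 0" using w norm_ge_zero order_trans by blast
    then have "L \<ge> 0" using B by (simp add: L_def)
    then have C: "C \<ge> 0" by (simp add: C_def)
    have "cmod (\<Prod>\<tau><m n. avg_exp N a (\<mu> w n \<tau>)) \<le> exp (C * T)"
    proof (cases "n = 0")
      case True
      then show ?thesis using C t by (simp add: m_def)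
    next
      case False
      have "cmod (\<Prod>\<tau><m n. avg_exp N a (\<mu> w n \<tau>)) \<le> (\<Prod>\<tau><m n. exp (C / real n))"
        unfolding prod_norm[symmetric] C_def using avg_exp_estimates(1)[OF N _ \<mu>[OF w]] False
        by (intro prod_mono) (auto simp: L_def)
      also have "\<dots> \<le> exp (C * T)" using K_pow[OF C] False by simp
      finally show ?thesis .
    qed
    then show "cmod (\<Prod>\<tau><nat \<lfloor>real n * t\<rfloor>. avg_exp N a (w * (\<phi> (real \<tau> / real n) / of_real (root N (real n)))))
        \<le> exp (((R * B * cmod a) ^ N + exp (R * B * cmod a) * (R * B * cmod a) ^ Suc N) * T)"
      unfolding m_def \<mu>_def C_def L_def .
  qed
  define L where "L = cmod w * B * cmod a"
  define C where "C = L ^ N + exp L * L ^ Suc N"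
  define C' where "C' = exp L * L ^ Suc N + exp (L ^ N) * (L ^ N)\<^sup>2"
  define v where "v n \<tau> = \<mu> w n \<tau> ^ N * a ^ N / fact N" for n \<tau>
  have "L \<ge> 0" using B by (simp add: L_def)
  then have C: "C \<ge> 0" and C': "C' \<ge> 0" by (auto simp: C_def C'_def)
  have bound: "cmod (?P n - (\<Prod>\<tau><m n. exp (v n \<tau>))) \<le> exp (C * T) * (T * C') * inverse (root N (real n))"
    if n: "n > 0" for n
  proof -
    note est = avg_exp_estimates[OF N n \<mu>[of w "cmod w", OF order_refl n], folded L_def, folded C_def C'_def]
    have "cmod (?P n - (\<Prod>\<tau><m n. exp (v n \<tau>))) \<le>
        exp (C / real n) ^ m n * (\<Sum>\<tau><m n. cmod (avg_exp N a (\<mu> w n \<tau>) - exp (v n \<tau>)))"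
      unfolding m_def[symmetric] \<mu>_def[symmetric] v_def
      using est C by (intro norm_prod_diff_le) auto
    also have "\<dots> \<le> exp (C * T) * (\<Sum>\<tau><m n. C' / (real n * root N (real n)))"
      using est(3) K_pow[OF C n] by (intro mult_mono sum_mono sum_nonneg) (auto simp: v_def)
    also have "(\<Sum>\<tau><m n. C' / (real n * root N (real n))) = (real (m n) / real n) * (C' * inverse (root N (real n)))"
      by (simp add: divide_inverse)
    also have "\<dots> \<le> T * (C' * inverse (root N (real n)))"
    proof (rule mult_right_mono)
      show "real (m n) / real n \<le> T" using m_le[of n] n by (simp add: field_simps)
      show "0 \<le> C' * inverse (root N (real n))" using C' N by (simp add: real_root_ge_zero)
    qed
    finally show ?thesis by (simp add: mult_ac)
  qed
  have "(\<lambda>n. real n powr - (1 / real N)) \<longlonglongrightarrow> 0"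
    using N by (intro tendsto_neg_powr filterlim_real_sequentially) auto
  then have "(\<lambda>n. inverse (root N (real n))) \<longlonglongrightarrow> 0"
    using N by (simp add: root_powr_inverse powr_minus)
  then have "(\<lambda>n. exp (C * T) * (T * C') * inverse (root N (real n))) \<longlonglongrightarrow> 0"
    by (rule tendsto_mult_right_zero)
  moreover have "\<forall>\<^sub>F n in sequentially.
      cmod (?P n - (\<Prod>\<tau><m n. exp (v n \<tau>))) \<le> exp (C * T) * (T * C') * inverse (root N (real n))"
    using eventually_gt_at_top[of 0] by eventually_elim (rule bound)
  ultimately have "(\<lambda>n. ?P n - (\<Prod>\<tau><m n. exp (v n \<tau>))) \<longlonglongrightarrow> 0"
    by (rule Lim_null_comparison[rotated])
  moreover have "(\<lambda>n. \<Prod>\<tau><m n. exp (v n \<tau>)) \<longlonglongrightarrow> exp (integral {0..t} (\<lambda>s. a ^ N / fact N * \<phi> s ^ N) * w ^ N)"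
  proof -
    have "(\<lambda>n. \<Sum>\<tau><m n. (a ^ N / fact N * \<phi> (real \<tau> / real n) ^ N) / of_nat n)
        \<longlonglongrightarrow> integral {0..t} (\<lambda>s. a ^ N / fact N * \<phi> s ^ N)"
      unfolding m_def by (rule riemann_sum_tendsto_integral[OF _ t]) (intro continuous_intros \<phi>)
    then have lim: "(\<lambda>n. exp ((\<Sum>\<tau><m n. (a ^ N / fact N * \<phi> (real \<tau> / real n) ^ N) / of_nat n) * w ^ N))
        \<longlonglongrightarrow> exp (integral {0..t} (\<lambda>s. a ^ N / fact N * \<phi> s ^ N) * w ^ N)"
      by (intro tendsto_intros)
    \<comment> \<open>The \<open>N\<close>-th power of the scaling by \<open>1 / root N n\<close> is the mesh \<open>1 / n\<close> of the Riemann sum.\<close>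
    have sum_v: "(\<Sum>\<tau><m n. (a ^ N / fact N * \<phi> (real \<tau> / real n) ^ N) / of_nat n) * w ^ N = (\<Sum>\<tau><m n. v n \<tau>)"
      if n: "n > 0" for n
    proof -
      have "complex_of_real (root N (real n)) ^ N = of_nat n"
        using N by (simp add: of_real_power[symmetric] del: of_real_power)
      then show ?thesis
        by (simp add: v_def \<mu>_def sum_distrib_left power_mult_distrib power_divide mult_ac)
    qed
    have "\<forall>\<^sub>F n in sequentially. exp ((\<Sum>\<tau><m n. (a ^ N / fact N * \<phi> (real \<tau> / real n) ^ N) / of_nat n) * w ^ N)
        = (\<Prod>\<tau><m n. exp (v n \<tau>))"
      using eventually_gt_at_top[of 0] by eventually_elim (simp only: sum_v exp_sum finite_lessThan)
    then show ?thesis using lim by (rule Lim_transform_eventually[rotated])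
  qed
  ultimately show "?P \<longlonglongrightarrow> exp (integral {0..t} (\<lambda>s. a ^ N / fact N * \<phi> s ^ N) * w ^ N)"
    using tendsto_add by fastforce
qed

section \<open>Superpositions of exponential solutions\<close>

text \<open>The solution of \<open>\<partial>\<^sub>t u = A \<partial>\<^sub>x\<^sup>N u\<close> with initial datum \<open>exp (\<zeta> * x)\<close> is \<open>exp (\<zeta> * x + \<kappa> * \<zeta>\<^sup>N)\<close>,
  where \<open>\<kappa>\<close> is the integral of \<open>A\<close> up to time \<open>t\<close>. The transform superposes these with weight \<open>g\<close>,
  and \<open>k\<close> counts derivatives in \<open>x\<close>; a derivative in \<open>\<kappa>\<close> is \<open>N\<close> derivatives in \<open>x\<close>.\<close>

definition exp_transform :: "(real \<Rightarrow> complex) \<Rightarrow> (real \<Rightarrow> complex) \<Rightarrow> nat \<Rightarrow> nat \<Rightarrow> complex \<Rightarrow> real \<Rightarrow> complex" where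
  "exp_transform g \<zeta> N k \<kappa> x =
     integral {0..1} (\<lambda>\<theta>. g \<theta> * \<zeta> \<theta> ^ k * exp (\<zeta> \<theta> * complex_of_real x + \<kappa> * \<zeta> \<theta> ^ N))"

context
  fixes g \<zeta> :: "real \<Rightarrow> complex" and N :: nat
  assumes g: "continuous_on {0..1} g" and \<zeta>: "continuous_on {0..1} \<zeta>"
begin

lemma continuous_on_exp_transform:
  "continuous_on UNIV (\<lambda>(\<kappa>, x). exp_transform g \<zeta> N k \<kappa> x)"
proof -
  have "continuous_on (UNIV \<times> cbox 0 (1::real)) (\<lambda>p. g (snd p))"
    "continuous_on (UNIV \<times> cbox 0 (1::real)) (\<lambda>p. \<zeta> (snd p))"
    by (auto intro!: continuous_on_compose2[OF g] continuous_on_compose2[OF \<zeta>] continuous_intros)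
  then have "continuous_on (UNIV \<times> cbox 0 1)
      (\<lambda>(p :: complex \<times> real, \<theta>). g \<theta> * \<zeta> \<theta> ^ k * exp (\<zeta> \<theta> * complex_of_real (snd p) + fst p * \<zeta> \<theta> ^ N))"
    unfolding split_beta by (intro continuous_intros)
  from integral_continuous_on_param[OF this] show ?thesis
    by (simp add: exp_transform_def split_beta)
qed

lemma exp_transform_deriv_x:
  "(exp_transform g \<zeta> N k \<kappa> has_vector_derivative exp_transform g \<zeta> N (Suc k) \<kappa> x) (at x)"
proof -
  have gz: "continuous_on (UNIV \<times> cbox 0 (1::real)) (\<lambda>p. g (snd p))"
    "continuous_on (UNIV \<times> cbox 0 (1::real)) (\<lambda>p. \<zeta> (snd p))"
    by (auto intro!: continuous_on_compose2[OF g] continuous_on_compose2[OF \<zeta>] continuous_intros)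
  have "((\<lambda>x. integral (cbox 0 1) (\<lambda>\<theta>. g \<theta> * \<zeta> \<theta> ^ k * exp (\<zeta> \<theta> * complex_of_real x + \<kappa> * \<zeta> \<theta> ^ N)))
     has_vector_derivative integral (cbox 0 1) (\<lambda>\<theta>. g \<theta> * \<zeta> \<theta> ^ Suc k * exp (\<zeta> \<theta> * complex_of_real x + \<kappa> * \<zeta> \<theta> ^ N)))
     (at x within UNIV)"
  proof (rule leibniz_rule_vector_derivative)
    show "((\<lambda>x. g \<theta> * \<zeta> \<theta> ^ k * exp (\<zeta> \<theta> * complex_of_real x + \<kappa> * \<zeta> \<theta> ^ N)) has_vector_derivative
        g \<theta> * \<zeta> \<theta> ^ Suc k * exp (\<zeta> \<theta> * complex_of_real x + \<kappa> * \<zeta> \<theta> ^ N)) (at x within UNIV)" for x \<theta>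
    proof -
      have "((\<lambda>w. g \<theta> * \<zeta> \<theta> ^ k * exp (\<zeta> \<theta> * w + \<kappa> * \<zeta> \<theta> ^ N)) has_field_derivative
        g \<theta> * \<zeta> \<theta> ^ Suc k * exp (\<zeta> \<theta> * complex_of_real x + \<kappa> * \<zeta> \<theta> ^ N)) (at (complex_of_real x))"
        by (auto intro!: derivative_eq_intros)
      then show ?thesis
        by (rule has_vector_derivative_real_field)
    qed
    show "(\<lambda>\<theta>. g \<theta> * \<zeta> \<theta> ^ k * exp (\<zeta> \<theta> * complex_of_real x + \<kappa> * \<zeta> \<theta> ^ N)) integrable_on cbox 0 1" for x
      by (rule integrable_continuous) (auto intro!: continuous_intros g \<zeta>)
    show "continuous_on (UNIV \<times> cbox 0 1)
        (\<lambda>(x, \<theta>). g \<theta> * \<zeta> \<theta> ^ Suc k * exp (\<zeta> \<theta> * complex_of_real x + \<kappa> * \<zeta> \<theta> ^ N))"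
      unfolding split_beta by (intro continuous_intros gz)
  qed auto
  then show ?thesis
    by (simp add: exp_transform_def[abs_def])
qed

lemma exp_transform_deriv_param:
  "((\<lambda>\<kappa>. exp_transform g \<zeta> N k \<kappa> x) has_field_derivative exp_transform g \<zeta> N (N + k) \<kappa> x) (at \<kappa>)"
proof -
  have gz: "continuous_on (UNIV \<times> cbox 0 (1::real)) (\<lambda>p. g (snd p))"
    "continuous_on (UNIV \<times> cbox 0 (1::real)) (\<lambda>p. \<zeta> (snd p))"
    by (auto intro!: continuous_on_compose2[OF g] continuous_on_compose2[OF \<zeta>] continuous_intros)
  have "((\<lambda>\<kappa>. integral (cbox 0 1) (\<lambda>\<theta>. g \<theta> * \<zeta> \<theta> ^ k * exp (\<zeta> \<theta> * complex_of_real x + \<kappa> * \<zeta> \<theta> ^ N)))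
     has_field_derivative integral (cbox 0 1) (\<lambda>\<theta>. g \<theta> * \<zeta> \<theta> ^ (N + k) * exp (\<zeta> \<theta> * complex_of_real x + \<kappa> * \<zeta> \<theta> ^ N)))
     (at \<kappa> within UNIV)"
  proof (rule leibniz_rule_field_derivative)
    show "((\<lambda>\<kappa>. g \<theta> * \<zeta> \<theta> ^ k * exp (\<zeta> \<theta> * complex_of_real x + \<kappa> * \<zeta> \<theta> ^ N)) has_field_derivative
        g \<theta> * \<zeta> \<theta> ^ (N + k) * exp (\<zeta> \<theta> * complex_of_real x + \<kappa> * \<zeta> \<theta> ^ N)) (at \<kappa> within UNIV)" for \<kappa> \<theta>
      by (auto intro!: derivative_eq_intros simp: power_add)
    show "(\<lambda>\<theta>. g \<theta> * \<zeta> \<theta> ^ k * exp (\<zeta> \<theta> * complex_of_real x + \<kappa> * \<zeta> \<theta> ^ N)) integrable_on cbox 0 1" for \<kappa>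
      by (rule integrable_continuous) (auto intro!: continuous_intros g \<zeta>)
    show "continuous_on (UNIV \<times> cbox 0 1)
        (\<lambda>(\<kappa>, \<theta>). g \<theta> * \<zeta> \<theta> ^ (N + k) * exp (\<zeta> \<theta> * complex_of_real x + \<kappa> * \<zeta> \<theta> ^ N))"
      unfolding split_beta by (intro continuous_intros gz)
  qed auto
  then show ?thesis
    by (simp add: exp_transform_def)
qed

text \<open>By the chain rule with \<open>\<kappa> = integral {0..t} A\<close>, a time derivative is \<open>A(t)\<close> times a derivative in \<open>\<kappa>\<close>, that is,
  \<open>A(t)\<close> times an \<open>N\<close>-th derivative in \<open>x\<close>.\<close>

lemma exp_transform_classical_solution:
  assumes A: "continuous_on {0..T} A"
    and f: "\<And>x. f x = exp_transform g \<zeta> N 0 0 x"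
    and u: "\<And>t x. t \<in> {0..T} \<Longrightarrow> u t x = exp_transform g \<zeta> N 0 (integral {0..t} A) x"
    and T: "T \<ge> 0"
  shows "classical_solution T N A f u"
proof -
  define K where "K t = integral {0..t} A" for t
  define D where "D k t = exp_transform g \<zeta> N k (K t)" for k t
  have K': "(K has_vector_derivative A t) (at t within {0..T})" if "t \<in> {0..T}" for t
    unfolding K_def using A that by (rule integral_has_vector_derivative)
  have K: "continuous_on {0..T} K"
    using K' by (rule continuous_on_vector_derivative)
  have D_cont: "continuous_on ({0..T} \<times> UNIV) (\<lambda>(t, x). D k t x)" for k
  proof -
    have "continuous_on ({0..T} \<times> UNIV) (\<lambda>p. (K (fst p), snd p))"
      by (intro continuous_intros continuous_on_compose2[OF K]) auto
    from continuous_on_compose2[OF continuous_on_exp_transform this]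
    show ?thesis by (simp add: D_def split_beta)
  qed
  have A_cont: "continuous_on ({0..T} \<times> UNIV) (\<lambda>p. A (fst p))"
    by (intro continuous_on_compose2[OF A] continuous_intros) auto
  have u': "((\<lambda>s. u s x) has_vector_derivative A t * D N t x) (at t within {0..T})"
    if t: "t \<in> {0..T}" for t x
  proof -
    have "((\<lambda>\<kappa>. exp_transform g \<zeta> N 0 \<kappa> x) has_field_derivative D N t x) (at (K t) within K ` {0..T})"
      using exp_transform_deriv_param[of 0 x "K t"] by (simp add: D_def has_field_derivative_at_within)
    from field_vector_diff_chain_within[OF K'[OF t] this]
    have "((\<lambda>s. exp_transform g \<zeta> N 0 (K s) x) has_vector_derivative A t * D N t x) (at t within {0..T})"
      by (simp add: o_def)
    then show ?thesis
      by (rule has_vector_derivative_transform[OF t, rotated]) (simp add: u K_def)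
  qed
  have "u 0 x = f x" for x
    using T by (simp add: u f)
  moreover have "continuous_on ({0..T} \<times> UNIV) (\<lambda>(t, x). A t * D N t x)"
    using continuous_on_mult[OF A_cont D_cont[of N]] by (simp add: split_beta)
  moreover have "(D k t has_vector_derivative D (Suc k) t x) (at x)" for k t x
    unfolding D_def by (rule exp_transform_deriv_x)
  moreover have "D 0 t x = u t x" if "t \<in> {0..T}" for t x
    using that by (simp add: D_def u K_def)
  ultimately show ?thesis
    unfolding classical_solution_def using u' D_cont
    by (intro conjI exI[of _ "\<lambda>t x. A t * D N t x"] exI[of _ D] ballI allI impI) auto
qed

end

section \<open>The limit of the expectations\<close>

text \<open>The frequencies \<open>\<zeta> \<theta>\<close> stay in a bounded set, on which the products converge pointwise and
  boundedly, so the limit passes through the integral.\<close>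

lemma (in prob_space) expectation_exponential_tendsto:
  fixes g \<zeta> :: "real \<Rightarrow> complex"
  assumes N: "N > 0" and iid: "iid_uniform M \<xi> (scaled_roots_of_unity N a)"
    and g: "continuous_on {0..1} g" and \<zeta>: "continuous_on {0..1} \<zeta>"
    and F: "\<And>z. ((\<lambda>\<theta>. g \<theta> * exp (\<zeta> \<theta> * z)) has_integral F z) {0..1}"
    and \<phi>: "continuous_on {0..T} \<phi>" and t: "t \<in> {0..T}"
  shows "(\<lambda>n. expectation (\<lambda>\<omega>. F (complex_of_real x + wiener_integral N \<xi> n \<phi> t \<omega>)))
    \<longlonglongrightarrow> exp_transform g \<zeta> N 0 (integral {0..t} (\<lambda>s. a ^ N / fact N * \<phi> s ^ N)) x"
proof -
  define P where "P n w = (\<Prod>\<tau><nat \<lfloor>real n * t\<rfloor>. avg_exp N a (w * (\<phi> (real \<tau> / real n) / of_real (root N (real n)))))" for n w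
  define h where "h n \<theta> = g \<theta> * exp (\<zeta> \<theta> * complex_of_real x) * P n (\<zeta> \<theta>)" for n \<theta>
  define \<kappa> where "\<kappa> = integral {0..t} (\<lambda>s. a ^ N / fact N * \<phi> s ^ N)"
  have E: "(h n has_integral expectation (\<lambda>\<omega>. F (complex_of_real x + wiener_integral N \<xi> n \<phi> t \<omega>))) {0..1}" for n
    using expectation_exponential_transform[OF N iid g \<zeta> F, where x = "complex_of_real x" and m = "nat \<lfloor>real n * t\<rfloor>"
        and c = "\<lambda>\<tau>. \<phi> (real \<tau> / real n) / of_real (root N (real n))"]
    by (simp add: h_def[abs_def] P_def wiener_integral_def sum_divide_distrib)
  have \<zeta>_bdd: "bounded (\<zeta> ` {0..1})" and "bounded ((\<lambda>\<theta>. g \<theta> * exp (\<zeta> \<theta> * complex_of_real x)) ` {0..1})"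
    by (intro compact_imp_bounded compact_continuous_image continuous_intros g \<zeta> compact_Icc)+
  then obtain R G where R: "\<And>\<theta>. \<theta> \<in> {0..1} \<Longrightarrow> cmod (\<zeta> \<theta>) \<le> R"
    and G: "\<And>\<theta>. \<theta> \<in> {0..1} \<Longrightarrow> cmod (g \<theta> * exp (\<zeta> \<theta> * complex_of_real x)) \<le> G"
    unfolding bounded_iff by (metis imageI)
  obtain C where C: "\<And>n w. cmod w \<le> R \<Longrightarrow> cmod (P n w) \<le> C"
    using prod_avg_exp_limit(2)[OF N \<phi> t, of R a] unfolding P_def by blast
  have "(\<lambda>n. integral {0..1} (h n)) \<longlonglongrightarrow>
      integral {0..1} (\<lambda>\<theta>. g \<theta> * exp (\<zeta> \<theta> * complex_of_real x) * exp (\<kappa> * \<zeta> \<theta> ^ N))"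
  proof (rule dominated_convergence)
    show "h n integrable_on {0..1}" for n
      using E by blast
    show "(\<lambda>_. G * C) integrable_on {0..1::real}"
      by (rule integrable_const_ivl)
    show "cmod (h n \<theta>) \<le> G * C" if "\<theta> \<in> {0..1}" for n \<theta>
      unfolding h_def norm_mult[of _ "P n (\<zeta> \<theta>)"] using G[OF that] C[OF R[OF that]]
      by (intro mult_mono) (auto intro: order_trans[OF norm_ge_zero])
    show "(\<lambda>n. h n \<theta>) \<longlonglongrightarrow> g \<theta> * exp (\<zeta> \<theta> * complex_of_real x) * exp (\<kappa> * \<zeta> \<theta> ^ N)" for \<theta>
      unfolding h_def P_def \<kappa>_def by (intro tendsto_mult_left prod_avg_exp_limit(1)[OF N \<phi> t])
  qed
  then show ?thesis
    using integral_unique[OF E] by (simp add: exp_transform_def exp_add \<kappa>_def mult.assoc)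
qed

theorem theorem19:
  fixes N :: nat and \<alpha> a :: complex and M :: "'a measure" and \<xi> :: "nat \<Rightarrow> 'a \<Rightarrow> complex"
    and T :: real and \<phi> :: "real \<Rightarrow> complex" and F :: "complex \<Rightarrow> complex"
    and f :: "real \<Rightarrow> complex" and u :: "real \<Rightarrow> real \<Rightarrow> complex"
  assumes "N > 2"
    and "a ^ N = \<alpha>"
    and "prob_space M"
    and "iid_uniform M \<xi> (scaled_roots_of_unity N a)"
    and "T > 0"
    and "continuous_on {0..T} \<phi>" and "bounded (\<phi> ` {0..T})"
    and "of_exponential_type F"
    and "\<And>x. f x = F (complex_of_real x)"
    and "\<And>t x. t \<in> {0..T} \<Longrightarrow>
      u t x = lim (\<lambda>n. prob_space.expectation M
        (\<lambda>\<omega>. F (complex_of_real x + wiener_integral N \<xi> n \<phi> t \<omega>)))"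
  shows "(\<forall>t\<in>{0..T}. \<forall>x. convergent (\<lambda>n. prob_space.expectation M
           (\<lambda>\<omega>. F (complex_of_real x + wiener_integral N \<xi> n \<phi> t \<omega>)))) \<and>
         classical_solution T N (\<lambda>t. \<alpha> / fact N * \<phi> t ^ N) f u"
proof -
  interpret prob_space M by fact
  have N: "N > 0" using assms(1) by simp
  obtain \<zeta> g :: "real \<Rightarrow> complex" where \<zeta>: "continuous_on {0..1} \<zeta>" and g: "continuous_on {0..1} g"
    and F: "\<And>z. ((\<lambda>\<theta>. g \<theta> * exp (\<zeta> \<theta> * z)) has_integral F z) {0..1}"
    using exponential_type_borel_representation[OF assms(8)] by blast
  have lim: "(\<lambda>n. expectation (\<lambda>\<omega>. F (complex_of_real x + wiener_integral N \<xi> n \<phi> t \<omega>)))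
      \<longlonglongrightarrow> exp_transform g \<zeta> N 0 (integral {0..t} (\<lambda>s. \<alpha> / fact N * \<phi> s ^ N)) x"
    if t: "t \<in> {0..T}" for t x
    using expectation_exponential_tendsto[OF N assms(4) g \<zeta> F assms(6) t, of x]
    unfolding assms(2) .
  have "classical_solution T N (\<lambda>t. \<alpha> / fact N * \<phi> t ^ N) f u"
  proof (rule exp_transform_classical_solution[OF g \<zeta>])
    show "continuous_on {0..T} (\<lambda>t. \<alpha> / fact N * \<phi> t ^ N)"
      by (intro continuous_intros assms)
    show "f x = exp_transform g \<zeta> N 0 0 x" for x
      using integral_unique[OF F] by (simp add: assms(9) exp_transform_def)
    show "u t x = exp_transform g \<zeta> N 0 (integral {0..t} (\<lambda>t. \<alpha> / fact N * \<phi> t ^ N)) x"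
      if "t \<in> {0..T}" for t x
      unfolding assms(10)[OF that] by (rule limI[OF lim[OF that]])
  qed (use assms(5) in simp)
  moreover have "\<forall>t\<in>{0..T}. \<forall>x. convergent (\<lambda>n. expectation
      (\<lambda>\<omega>. F (complex_of_real x + wiener_integral N \<xi> n \<phi> t \<omega>)))"
    using lim by (intro ballI allI convergentI)
  ultimately show ?thesis
    by (intro conjI)
qed

end
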